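(* Let $\mathfrak g$ be a finite-dimensional complex Lie algebra with an ad-invariant ($\mathbb C$-bilinear) metric $g$, and let $\mathfrak g^{\mathbb R}$ be the underlying real Lie algebra, with the ad-invariant metric $g^{\mathbb R}=\mathrm{Re}\, g$. Then $\mathfrak g$ is solitary if and only if $\mathfrak g^{\mathbb R}$ is solitary.
   Context: Let $\mathbb K=\mathbb R$ or $\mathbb C$. A metric on a Lie algebra over $\mathbb K$ is a nondegenerate symmetric $\mathbb K$-bilinear form $g$; it is ad-invariant if $g([X,Y],Z)=-g(Y,[X,Z])$ for all $X,Y,Z$. A $\mathbb K$-linear endomorphism $\phi$ is ad-invariant if $\phi([X,Y])=[X,\phi(Y)]$ for all $X,Y$. For a linear map $f$, $f^{*_g}$ denotes its adjoint with respect to $g$. An ad-invariant metric $g$ is solitary if every ad-invariant $g$-self-adjoint $\mathbb K$-linear endomorphism $\phi$ of the Lie algebra can be written as $\phi=D+D^{*_g}$ for some ($\mathbb K$-linear) derivation $D$. A Lie algebra is solitary if it admits an ad-invariant metric and one (equivalently, every) ad-invariant metric on it is solitary. *)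

theory Defs
  imports Complex_Main
begin

definition bilinear_map ::
  "('k::field \<Rightarrow> 'a::ab_group_add \<Rightarrow> 'a) \<Rightarrow> ('k \<Rightarrow> 'b::ab_group_add \<Rightarrow> 'b) \<Rightarrow> ('a \<Rightarrow> 'a \<Rightarrow> 'b) \<Rightarrow> bool"
  where "bilinear_map s t f \<longleftrightarrow>
    (\<forall>x. Vector_Spaces.linear s t (\<lambda>y. f x y)) \<and> (\<forall>y. Vector_Spaces.linear s t (\<lambda>x. f x y))"

locale lie_algebra = vector_space scale
  for scale :: "'k::field \<Rightarrow> 'a::ab_group_add \<Rightarrow> 'a" +
  fixes bracket :: "'a \<Rightarrow> 'a \<Rightarrow> 'a"
  assumes bilinear_bracket: "bilinear_map scale scale bracket"
    and bracket_self: "bracket x x = 0"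
    and jacobi: "bracket x (bracket y z) + bracket y (bracket z x) + bracket z (bracket x y) = 0"

locale ad_invariant_metric = lie_algebra scale bracket
  for scale :: "'k::field \<Rightarrow> 'a::ab_group_add \<Rightarrow> 'a" and bracket :: "'a \<Rightarrow> 'a \<Rightarrow> 'a" +
  fixes g :: "'a \<Rightarrow> 'a \<Rightarrow> 'k"
  assumes bilinear_metric: "bilinear_map scale (*) g"
    and symmetric: "g x y = g y x"
    and nondegenerate: "(\<And>y. g x y = 0) \<Longrightarrow> x = 0"
    and ad_invariant: "g (bracket x y) z = - g y (bracket x z)"

definition derivation ::
  "('k::field \<Rightarrow> 'a::ab_group_add \<Rightarrow> 'a) \<Rightarrow> ('a \<Rightarrow> 'a \<Rightarrow> 'a) \<Rightarrow> ('a \<Rightarrow> 'a) \<Rightarrow> bool"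
  where "derivation scale bracket D \<longleftrightarrow> Vector_Spaces.linear scale scale D \<and>
    (\<forall>x y. D (bracket x y) = bracket (D x) y + bracket x (D y))"

definition ad_invariant_endo ::
  "('k::field \<Rightarrow> 'a::ab_group_add \<Rightarrow> 'a) \<Rightarrow> ('a \<Rightarrow> 'a \<Rightarrow> 'a) \<Rightarrow> ('a \<Rightarrow> 'a) \<Rightarrow> bool"
  where "ad_invariant_endo scale bracket \<phi> \<longleftrightarrow> Vector_Spaces.linear scale scale \<phi> \<and>
    (\<forall>x y. \<phi> (bracket x y) = bracket x (\<phi> y))"

text \<open>For a nondegenerate \<open>g\<close> on a finite-dimensional space and a linear \<open>f\<close>, the adjoint exists
  and is unique; in other situations the value may be unspecified.\<close>

definition adjoint_wrt :: "('a \<Rightarrow> 'a \<Rightarrow> 'k) \<Rightarrow> ('a \<Rightarrow> 'a) \<Rightarrow> 'a \<Rightarrow> 'a"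
  where "adjoint_wrt g f = (THE f'. \<forall>x y. g (f x) y = g x (f' y))"

definition solitary_metric ::
  "('k::field \<Rightarrow> 'a::ab_group_add \<Rightarrow> 'a) \<Rightarrow> ('a \<Rightarrow> 'a \<Rightarrow> 'a) \<Rightarrow> ('a \<Rightarrow> 'a \<Rightarrow> 'k) \<Rightarrow> bool"
  where "solitary_metric scale bracket g \<longleftrightarrow> ad_invariant_metric scale bracket g \<and>
    (\<forall>\<phi>. ad_invariant_endo scale bracket \<phi> \<and> adjoint_wrt g \<phi> = \<phi> \<longrightarrow>
      (\<exists>D. derivation scale bracket D \<and> (\<forall>x. \<phi> x = D x + adjoint_wrt g D x)))"

definition solitary ::
  "('k::field \<Rightarrow> 'a::ab_group_add \<Rightarrow> 'a) \<Rightarrow> ('a \<Rightarrow> 'a \<Rightarrow> 'a) \<Rightarrow> bool"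
  where "solitary scale bracket \<longleftrightarrow> (\<exists>g. solitary_metric scale bracket g)"

definition restrict_to_real :: "(complex \<Rightarrow> 'a \<Rightarrow> 'a) \<Rightarrow> real \<Rightarrow> 'a \<Rightarrow> 'a"
  where "restrict_to_real scale r x = scale (complex_of_real r) x"

end

theory Submission
  imports Defs
begin

text \<open>
  Once adjoints are eliminated, \<open>g\<close> is solitary iff every ad-invariant self-adjoint \<open>\<phi>\<close> satisfies
  \<open>g (\<phi> x) y = g (D x) y + g x (D y)\<close> for some derivation \<open>D\<close>. Whether this holds does not depend on
  the metric, so \<open>Re g\<close> may be used on the real side. Write \<open>J\<close> for multiplication by \<open>\<i>\<close>; it commutes with
  brackets and is self-adjoint, so real endomorphisms split into a complex linear and an antilinear
  part.

  If \<open>g\<close> is solitary and \<open>\<phi>\<close> is a real ad-invariant self-adjoint map, then its antilinear part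
  vanishes on the derived algebra and takes values in the centre. Hence half of it is a self-adjoint
  derivation, while the complex linear part is handled by \<open>g\<close>.

  Conversely, if \<open>\<phi>\<close> is complex linear and decomposes by a real derivation \<open>D\<close>, then
  the complex linear part of \<open>D\<close> is again a derivation and decomposes \<open>\<phi>\<close> too.
\<close>

section \<open>Calculation rules for linear maps, brackets and metrics\<close>

lemma linear_map_add: "Vector_Spaces.linear s t f \<Longrightarrow> f (x + y) = f x + f y"
  and linear_map_scale: "Vector_Spaces.linear s t f \<Longrightarrow> f (s c x) = t c (f x)"
  by (simp_all add: Vector_Spaces.linear_iff)

lemma linear_map_diff: "Vector_Spaces.linear s t f \<Longrightarrow> f (x - y) = f x - f y"
  by (metis add_diff_cancel_right' diff_add_cancel linear_map_add)

lemma linear_map_zero: "Vector_Spaces.linear s t f \<Longrightarrow> f 0 = 0"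
  by (metis cancel_comm_monoid_add_class.diff_cancel linear_map_diff)

lemma linear_map_minus: "Vector_Spaces.linear s t f \<Longrightarrow> f (- x) = - f x"
  by (metis diff_0 linear_map_diff linear_map_zero)

context lie_algebra
begin

lemma linear_bracket_right: "Vector_Spaces.linear scale scale (\<lambda>y. bracket x y)"
  and linear_bracket_left: "Vector_Spaces.linear scale scale (\<lambda>x. bracket x y)"
  using bilinear_bracket by (auto simp: bilinear_map_def)

lemmas bracket_simps =
  linear_map_add[OF linear_bracket_right] linear_map_add[OF linear_bracket_left]
  linear_map_diff[OF linear_bracket_right] linear_map_diff[OF linear_bracket_left]
  linear_map_minus[OF linear_bracket_right] linear_map_minus[OF linear_bracket_left]
  linear_map_scale[OF linear_bracket_right] linear_map_scale[OF linear_bracket_left]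

lemma bracket_anti: "bracket x y = - bracket y x"
proof -
  \<comment> \<open>Polarisation: the square terms in the expansion vanish, and so does the
    right-hand side.\<close>
  have "bracket x y + bracket y x = bracket (x + y) (x + y)"
    by (simp only: bracket_simps(1-2)) (simp add: bracket_self add.commute)
  then show ?thesis
    by (simp add: bracket_self eq_neg_iff_add_eq_0)
qed

end

context ad_invariant_metric
begin

lemma linear_metric_right: "Vector_Spaces.linear scale (*) (\<lambda>y. g x y)"
  and linear_metric_left: "Vector_Spaces.linear scale (*) (\<lambda>x. g x y)"
  using bilinear_metric by (auto simp: bilinear_map_def)

lemmas metric_simps =
  linear_map_add[OF linear_metric_right] linear_map_add[OF linear_metric_left]
  linear_map_diff[OF linear_metric_right] linear_map_diff[OF linear_metric_left]
  linear_map_minus[OF linear_metric_right] linear_map_minus[OF linear_metric_left]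
  linear_map_scale[OF linear_metric_right] linear_map_scale[OF linear_metric_left]

lemma metric_eqI:
  assumes "\<And>y. g x y = g x' y"
  shows "x = x'"
  using nondegenerate[of "x - x'"] assms by (simp add: metric_simps)

text \<open>Nondegeneracy leaves room for only one adjoint, so any candidate satisfying the defining
  identity is the value of the definite description.\<close>

lemma adjoint_wrt_eqI:
  assumes "\<And>x y. g (f x) y = g x (f' y)"
  shows "adjoint_wrt g f = f'"
  unfolding adjoint_wrt_def
proof (rule the_equality)
  show "\<forall>x y. g (f x) y = g x (f' y)"
    using assms by simp
next
  fix h
  assume "\<forall>x y. g (f x) y = g x (h y)"
  then have "g (h y) x = g (f' y) x" for x y
    using assms by (metis symmetric)
  then show "h = f'"
    using metric_eqI by blast
qed

end

section \<open>Representing functionals and forms by the metric in finite dimension\<close>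

locale finite_dimensional_metric_lie_algebra =
  finite_dimensional_vector_space scale Basis + ad_invariant_metric scale bracket g
  for scale :: "'k::field \<Rightarrow> 'a::ab_group_add \<Rightarrow> 'a" and Basis bracket g
begin

text \<open>Let \<open>T z\<close> be the vector whose coordinates are the values
  \<open>g b z\<close> on the basis. Nondegeneracy makes \<open>T\<close> injective, finite
  dimension makes it surjective, and a preimage of the vector with coordinates \<open>f b\<close>
  represents \<open>f\<close>.\<close>

lemma metric_represents_functional:
  assumes f: "Vector_Spaces.linear scale (*) f"
  obtains z where "\<And>x. f x = g z x"
proof -
  define T where "T = (\<lambda>z. \<Sum>b\<in>Basis. scale (g b z) b)"
  have lin: "Vector_Spaces.linear scale scale T"
    unfolding Vector_Spaces.linear_iff T_def
    by (simp add: vector_space_axioms metric_simps scale_left_distrib sum.distrib scale_sum_right)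
  have coeff: "c b = d b" if "(\<Sum>b\<in>Basis. scale (c b) b) = (\<Sum>b\<in>Basis. scale (d b) b)" "b \<in> Basis" for c d b
  proof -
    have "(\<Sum>b\<in>Basis. scale (c b - d b) b) = 0"
      using that by (simp add: scale_left_diff_distrib sum_subtractf)
    then show ?thesis
      using independentD[OF independent_Basis finite_Basis subset_refl, of "\<lambda>b. c b - d b" b] that by simp
  qed
  have ext: "h x = k x"
    if "Vector_Spaces.linear scale (*) h" "Vector_Spaces.linear scale (*) k"
      "\<And>b. b \<in> Basis \<Longrightarrow> h b = k b" for h k :: "'a \<Rightarrow> 'k" and x
  proof -
    have "x \<in> span Basis"
      by (simp add: span_Basis)
    then show ?thesis
      by (induction rule: span_induct_alt)
        (simp_all add: that linear_map_add[OF that(1)] linear_map_add[OF that(2)]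
          linear_map_scale[OF that(1)] linear_map_scale[OF that(2)] linear_map_zero[OF that(1)] linear_map_zero[OF that(2)])
  qed
  have "inj T"
  proof (rule injI)
    fix z w
    assume "T z = T w"
    then have "g b z = g b w" if "b \<in> Basis" for b
      using that coeff[of "\<lambda>b. g b z" "\<lambda>b. g b w" b] by (simp add: T_def)
    then have "g x z = g x w" for x
      using ext[OF linear_metric_left linear_metric_left] by blast
    then show "z = w"
      using metric_eqI symmetric by metis
  qed
  then have "surj T"
    using lin linear_inj_imp_surj by blast
  then obtain z where "T z = (\<Sum>b\<in>Basis. scale (f b) b)"
    by (metis surjD)
  then have "f b = g b z" if "b \<in> Basis" for b
    using that coeff[of "\<lambda>b. g b z" f b] by (simp add: T_def)
  then have "f x = g x z" for x
    using ext[OF f linear_metric_left] by blast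
  then show thesis
    using that symmetric by metis
qed

text \<open>Each functional \<open>h x\<close> has a representing vector; its uniqueness forces
  linear dependence on \<open>x\<close>. This yields both the existence of adjoints and the
  comparison of two metrics.\<close>

lemma metric_represents_form:
  assumes "\<And>x. Vector_Spaces.linear scale (*) (h x)"
    and "\<And>y. Vector_Spaces.linear scale (*) (\<lambda>x. h x y)"
  obtains f where "Vector_Spaces.linear scale scale f" "\<And>x y. h x y = g (f x) y"
proof -
  have "\<exists>z. \<forall>y. h x y = g z y" for x
    using metric_represents_functional[OF assms(1)] by metis
  then obtain f where f: "\<And>x y. h x y = g (f x) y"
    by metis
  have "f (x + y) = f x + f y" for x y
    by (rule metric_eqI)
      (simp add: metric_simps flip: f, simp add: linear_map_add[OF assms(2)])
  moreover have "f (scale c x) = scale c (f x)" for c x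
    by (rule metric_eqI)
      (simp add: metric_simps flip: f, simp add: linear_map_scale[OF assms(2)])
  ultimately have "Vector_Spaces.linear scale scale f"
    by (simp add: Vector_Spaces.linear_iff vector_space_axioms)
  then show thesis
    using that f by blast
qed

lemma adjoint_wrt:
  assumes f: "Vector_Spaces.linear scale scale f"
  shows "g (f x) y = g x (adjoint_wrt g f y)"
proof -
  have "Vector_Spaces.linear scale (*) (\<lambda>x. g y (f x))" "Vector_Spaces.linear scale (*) (\<lambda>y. g y (f x))" for x y
    using Vector_Spaces.linear_compose[OF f linear_metric_right] linear_metric_left
    by (simp_all add: comp_def)
  then obtain f' where "\<And>x y. g y (f x) = g (f' y) x"
    using metric_represents_form[of "\<lambda>y x. g y (f x)"] by metis
  then have "g (f x) y = g x (f' y)" for x y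
    by (metis symmetric)
  then show ?thesis
    using adjoint_wrt_eqI by metis
qed

section \<open>Solitary metrics without adjoints, and independence of the metric\<close>

lemma solitary_metric_iff:
  "solitary_metric scale bracket g \<longleftrightarrow>
    (\<forall>\<phi>. ad_invariant_endo scale bracket \<phi> \<and> (\<forall>x y. g (\<phi> x) y = g x (\<phi> y)) \<longrightarrow>
      (\<exists>D. derivation scale bracket D \<and> (\<forall>x y. g (\<phi> x) y = g (D x) y + g x (D y))))"
proof -
  have self: "adjoint_wrt g \<phi> = \<phi> \<longleftrightarrow> (\<forall>x y. g (\<phi> x) y = g x (\<phi> y))"
    if "ad_invariant_endo scale bracket \<phi>" for \<phi>
    using that adjoint_wrt adjoint_wrt_eqI unfolding ad_invariant_endo_def by metis
  have dec: "(\<forall>x. \<phi> x = D x + adjoint_wrt g D x) \<longleftrightarrow> (\<forall>x y. g (\<phi> x) y = g (D x) y + g x (D y))"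
    if "derivation scale bracket D" for \<phi> D
  proof -
    have "g x (D y) = g (adjoint_wrt g D x) y" for x y
      using adjoint_wrt[of D y x] that by (simp add: derivation_def symmetric)
    then have "(\<forall>y. g (\<phi> x) y = g (D x) y + g x (D y)) \<longleftrightarrow> (\<forall>y. g (\<phi> x) y = g (D x + adjoint_wrt g D x) y)" for x
      by (simp add: metric_simps)
    then show ?thesis
      using metric_eqI by metis
  qed
  show ?thesis
    unfolding solitary_metric_def using self dec ad_invariant_metric_axioms by metis
qed

text \<open>If \<open>g x y = h (\<psi> x) y\<close>, then \<open>\<psi>\<close> is invertible and commutes with all inner derivations, so
  \<open>D \<mapsto> inv \<psi> \<circ> D\<close> preserves derivations and carries decompositions for \<open>h\<close> to decompositions for \<open>g\<close>.\<close>
lemma solitary_metric_independent: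
  assumes sol: "solitary_metric scale bracket h"
  shows "solitary_metric scale bracket g"
  unfolding solitary_metric_iff
proof (intro allI impI)
  fix \<phi>
  assume \<phi>: "ad_invariant_endo scale bracket \<phi> \<and> (\<forall>x y. g (\<phi> x) y = g x (\<phi> y))"
  interpret h: ad_invariant_metric scale bracket h
    using sol by (simp add: solitary_metric_def)
  interpret h: finite_dimensional_metric_lie_algebra scale Basis bracket h ..
  obtain \<psi> where lin: "Vector_Spaces.linear scale scale \<psi>" and \<psi>: "\<And>x y. g x y = h (\<psi> x) y"
    using h.metric_represents_form[OF linear_metric_right linear_metric_left] by metis
  \<comment> \<open>Both metrics are ad-invariant: moving \<open>bracket x\<close> across
    \<open>g\<close>, passing to \<open>h\<close>, and moving it back leaves \<open>\<psi>\<close>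
    inside the bracket.\<close>
  have \<psi>_bracket: "\<psi> (bracket x y) = bracket x (\<psi> y)" for x y
    by (rule h.metric_eqI) (metis \<psi> ad_invariant h.ad_invariant)
  have "inj \<psi>"
    by (rule injI, rule metric_eqI) (simp add: \<psi>)
  then have "surj \<psi>"
    using lin linear_inj_imp_surj by blast
  define \<chi> where "\<chi> = inv \<psi>"
  have \<psi>\<chi>: "\<psi> (\<chi> x) = x" and \<chi>\<psi>: "\<chi> (\<psi> x) = x" for x
    using \<open>surj \<psi>\<close> \<open>inj \<psi>\<close> by (simp_all add: \<chi>_def surj_f_inv_f)
  have \<chi>_lin: "Vector_Spaces.linear scale scale \<chi>"
    unfolding Vector_Spaces.linear_iff using vector_space_axioms linear_map_add[OF lin] linear_map_scale[OF lin]
    by (metis \<chi>\<psi> \<psi>\<chi>)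
  have \<chi>_bracket: "\<chi> (bracket x y) = bracket x (\<chi> y)" for x y
    by (metis \<chi>\<psi> \<psi>\<chi> \<psi>_bracket)
  \<comment> \<open>With \<open>\<chi>\<close> free to enter either slot, the Leibniz rule for
    \<open>D\<close> turns into that for \<open>\<chi> \<circ> D\<close>.\<close>
  have \<chi>_bracket': "\<chi> (bracket x y) = bracket (\<chi> x) y" for x y
    by (metis bracket_anti \<chi>_bracket linear_map_minus[OF \<chi>_lin])
  \<comment> \<open>The form \<open>g (\<phi> x) y\<close> equals
    \<open>h (\<psi> (\<phi> x)) y\<close>, so \<open>\<psi> \<circ> \<phi>\<close> is the map to
    decompose with respect to \<open>h\<close>.\<close>
  have "ad_invariant_endo scale bracket (\<psi> \<circ> \<phi>)"
    using \<phi> Vector_Spaces.linear_compose[OF _ lin] by (auto simp: ad_invariant_endo_def \<psi>_bracket)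
  moreover have "h ((\<psi> \<circ> \<phi>) x) y = h x ((\<psi> \<circ> \<phi>) y)" for x y
    using \<phi> by (simp add: h.symmetric[of x] symmetric flip: \<psi>)
  ultimately obtain D where D: "derivation scale bracket D"
    and dec: "\<And>x y. h ((\<psi> \<circ> \<phi>) x) y = h (D x) y + h x (D y)"
    using sol unfolding h.solitary_metric_iff by blast
  have "derivation scale bracket (\<chi> \<circ> D)"
    using D Vector_Spaces.linear_compose[OF _ \<chi>_lin]
    by (auto simp: derivation_def linear_map_add[OF \<chi>_lin] \<chi>_bracket simp flip: \<chi>_bracket')
  moreover have "g (\<phi> x) y = g ((\<chi> \<circ> D) x) y + g x ((\<chi> \<circ> D) y)" for x y
  proof -
    have "g ((\<chi> \<circ> D) x) y = h (D x) y" for x y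
      by (simp add: \<psi> \<psi>\<chi>)
    then show ?thesis
      using dec[of x y] by (metis \<psi> comp_apply symmetric h.symmetric)
  qed
  ultimately show "\<exists>D. derivation scale bracket D \<and> (\<forall>x y. g (\<phi> x) y = g (D x) y + g x (D y))"
    by blast
qed

lemma solitary_iff_solitary_metric: "solitary scale bracket \<longleftrightarrow> solitary_metric scale bracket g"
  using solitary_metric_independent by (auto simp: solitary_def)

end

section \<open>Restriction of scalars to the reals\<close>

lemma vector_space_restrict_to_real:
  assumes "vector_space scale"
  shows "vector_space (restrict_to_real scale)"
proof -
  interpret vector_space scale by fact
  show ?thesis
    by unfold_locales
      (simp_all add: restrict_to_real_def scale_right_distrib scale_left_distrib)
qed

lemma linear_restrict_to_real:
  assumes "Vector_Spaces.linear s t f"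
  shows "Vector_Spaces.linear (restrict_to_real s) (restrict_to_real t) f"
  using assms by (simp add: Vector_Spaces.linear_iff vector_space_restrict_to_real restrict_to_real_def)

lemma finite_dimensional_restrict_to_real:
  assumes "finite_dimensional_vector_space scale B"
  obtains C where "finite_dimensional_vector_space (restrict_to_real scale) C"
proof -
  interpret finite_dimensional_vector_space scale B by fact
  interpret R: vector_space "restrict_to_real scale"
    by (rule vector_space_restrict_to_real) (rule vector_space_axioms)
  define S where "S = R.span (B \<union> scale \<i> ` B)"
  have real: "scale (complex_of_real r) x \<in> S" if "x \<in> S" for r x
    using that R.span_scale[of x _ r] by (simp add: S_def restrict_to_real_def)
  have imaginary: "scale \<i> x \<in> S" if "x \<in> S" for x
    using that unfolding S_def
  proof (induction rule: R.span_induct_alt)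
    case base
    show ?case by (simp add: R.span_zero)
  next
    case (step c x y)
    \<comment> \<open>A generator \<open>x\<close> in \<open>B\<close> goes to another generator,
      and \<open>x = scale \<i> b\<close> goes to \<open>- b\<close>.\<close>
    have "scale \<i> x \<in> R.span (B \<union> scale \<i> ` B)"
      using step.hyps R.span_neg[OF R.span_base, of _ "B \<union> scale \<i> ` B"] by (auto intro: R.span_base)
    moreover have "scale \<i> (restrict_to_real scale c x + y) = restrict_to_real scale c (scale \<i> x) + scale \<i> y"
      by (simp add: restrict_to_real_def scale_right_distrib mult.commute)
    ultimately show ?case
      using step.IH R.span_add R.span_scale by metis
  qed
  have "x \<in> S" for x
  proof -
    have "x \<in> span B"
      by (simp add: span_Basis)
    then show ?thesis
    proof (induction rule: span_induct_alt)
      case base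
      show ?case by (simp add: S_def R.span_zero)
    next
      case (step c x y)
      then have "x \<in> S"
        by (simp add: S_def R.span_base)
      moreover have "scale c x = scale (complex_of_real (Re c)) x + scale (complex_of_real (Im c)) (scale \<i> x)"
        by (metis scale_left_distrib scale_scale complex_eq mult.commute)
      ultimately show ?case
        using step.IH real imaginary R.span_add unfolding S_def by metis
    qed
  qed
  then have span: "R.span (B \<union> scale \<i> ` B) = UNIV"
    by (auto simp: S_def)
  obtain C where "C \<subseteq> B \<union> scale \<i> ` B" "R.independent C" "B \<union> scale \<i> ` B \<subseteq> R.span C"
    using R.maximal_independent_subset by blast
  moreover have "finite C"
    using calculation(1) finite_Basis finite_subset by blast
  moreover have "R.span C = UNIV"
    using calculation(3) span by (metis R.span_mono R.span_span top.extremum_unique)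
  ultimately have "finite_dimensional_vector_space (restrict_to_real scale) C"
    by unfold_locales auto
  then show thesis
    using that by blast
qed

lemma ad_invariant_metric_restrict_to_real:
  assumes "ad_invariant_metric scale bracket g"
  shows "ad_invariant_metric (restrict_to_real scale) bracket (\<lambda>x y. Re (g x y))"
proof -
  interpret ad_invariant_metric scale bracket g by fact
  interpret R: vector_space "restrict_to_real scale"
    by (rule vector_space_restrict_to_real) (rule vector_space_axioms)
  have real: "vector_space ((*) :: real \<Rightarrow> real \<Rightarrow> real)"
    by unfold_locales (simp_all add: algebra_simps)
  show ?thesis
  proof
    show "bilinear_map (restrict_to_real scale) (restrict_to_real scale) bracket"
      by (simp add: bilinear_map_def linear_restrict_to_real linear_bracket_left linear_bracket_right)
    show "bracket x x = 0" for x
      by (rule bracket_self)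
    show "bracket x (bracket y z) + bracket y (bracket z x) + bracket z (bracket x y) = 0" for x y z
      by (rule jacobi)
    show "bilinear_map (restrict_to_real scale) (*) (\<lambda>x y. Re (g x y))"
      by (simp add: bilinear_map_def Vector_Spaces.linear_iff R.vector_space_axioms real metric_simps restrict_to_real_def)
    show "Re (g x y) = Re (g y x)" for x y
      by (simp add: symmetric)
    show "Re (g (bracket x y) z) = - Re (g y (bracket x z))" for x y z
      by (simp add: ad_invariant)
    show "x = 0" if "\<And>y. Re (g x y) = 0" for x
    proof (rule nondegenerate)
      \<comment> \<open>Testing against \<open>scale \<i> y\<close> recovers the imaginary part,
        since \<open>Re (\<i> * c) = - Im c\<close>.\<close>
      show "g x y = 0" for y
        using that[of y] that[of "scale \<i> y"] by (simp add: metric_simps complex_eq_iff)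
    qed
  qed
qed

section \<open>Complex linear and antilinear parts of real linear maps\<close>

locale complex_metric_lie_algebra =
  finite_dimensional_metric_lie_algebra scale Basis bracket g
  for scale :: "complex \<Rightarrow> 'a::ab_group_add \<Rightarrow> 'a" and Basis bracket g
begin

sublocale R: ad_invariant_metric "restrict_to_real scale" bracket "\<lambda>x y. Re (g x y)"
  by (rule ad_invariant_metric_restrict_to_real) (rule ad_invariant_metric_axioms)

abbreviation J where "J \<equiv> scale \<i>"

text \<open>Since \<open>J\<close> squares to \<open>-1\<close>, the conjugate of \<open>f\<close>
  by \<open>J\<close> is \<open>- J f J\<close>. The mean of \<open>f\<close> and this conjugate
  commutes with \<open>J\<close>; half their difference, \<open>antilin_part f\<close>, anticommutes
  with \<open>J\<close>.\<close>

definition lin_part :: "('a \<Rightarrow> 'a) \<Rightarrow> 'a \<Rightarrow> 'a"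
  where "lin_part f x = scale (1/2) (f x - J (f (J x)))"

definition antilin_part :: "('a \<Rightarrow> 'a) \<Rightarrow> 'a \<Rightarrow> 'a"
  where "antilin_part f x = scale (1/2) (f x + J (f (J x)))"

lemma scale_half_add_self: "scale (1/2) x + scale (1/2) x = x"
  by (simp flip: scale_left_distrib)

lemma lin_part_add_antilin_part: "lin_part f x + antilin_part f x = f x"
  by (simp add: lin_part_def antilin_part_def scale_right_distrib scale_right_diff_distrib scale_half_add_self)

lemma linear_of_real_linear:
  assumes f: "Vector_Spaces.linear (restrict_to_real scale) (restrict_to_real scale) f"
    and J: "\<And>x. f (J x) = J (f x)"
  shows "Vector_Spaces.linear scale scale f"
proof -
  have real: "f (scale (complex_of_real r) x) = scale (complex_of_real r) (f x)" for r x
    using linear_map_scale[OF f] by (simp add: restrict_to_real_def)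
  have decomp: "scale c x = scale (complex_of_real (Re c)) x + J (scale (complex_of_real (Im c)) x)" for c x
    by (metis scale_left_distrib scale_scale complex_eq)
  have "f (scale c x) = scale c (f x)" for c x
    by (metis decomp linear_map_add[OF f] real J)
  then show ?thesis
    using f by (simp add: Vector_Spaces.linear_iff vector_space_axioms)
qed

context
  fixes f :: "'a \<Rightarrow> 'a"
  assumes f: "Vector_Spaces.linear (restrict_to_real scale) (restrict_to_real scale) f"
begin

lemma real_linear_parts:
  "Vector_Spaces.linear (restrict_to_real scale) (restrict_to_real scale) (lin_part f)"
  "Vector_Spaces.linear (restrict_to_real scale) (restrict_to_real scale) (antilin_part f)"
proof -
  have real: "f (scale (complex_of_real r) x) = scale (complex_of_real r) (f x)" for r x
    using linear_map_scale[OF f] by (simp add: restrict_to_real_def)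
  have comm: "J (scale (complex_of_real r) x) = scale (complex_of_real r) (J x)" for r x
    by (simp add: mult.commute)
  have comm': "scale (1/2) (scale (complex_of_real r) x) = scale (complex_of_real r) (scale (1/2) x)" for r x
    by (simp add: mult.commute)
  show "Vector_Spaces.linear (restrict_to_real scale) (restrict_to_real scale) (lin_part f)"
    unfolding Vector_Spaces.linear_iff restrict_to_real_def lin_part_def comm real
    using R.vector_space_axioms
    by (simp only: scale_right_diff_distrib[symmetric] comm')
      (simp add: linear_map_add[OF f] scale_right_distrib scale_right_diff_distrib restrict_to_real_def [abs_def])
  show "Vector_Spaces.linear (restrict_to_real scale) (restrict_to_real scale) (antilin_part f)"
    unfolding Vector_Spaces.linear_iff restrict_to_real_def antilin_part_def comm real
    using R.vector_space_axioms
    by (simp only: scale_right_distrib[symmetric] comm')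
      (simp add: linear_map_add[OF f] scale_right_distrib restrict_to_real_def [abs_def])
qed

lemma lin_part_J: "lin_part f (J x) = J (lin_part f x)"
  by (simp add: lin_part_def linear_map_minus[OF f] scale_right_distrib scale_right_diff_distrib)

lemma antilin_part_J: "antilin_part f (J x) = - J (antilin_part f x)"
  by (simp add: antilin_part_def linear_map_minus[OF f] scale_right_distrib scale_right_diff_distrib)

lemma linear_lin_part: "Vector_Spaces.linear scale scale (lin_part f)"
  using real_linear_parts(1) lin_part_J by (rule linear_of_real_linear)

end

lemma metric_J: "g (J x) y = g x (J y)"
  by (simp add: metric_simps)

lemma bracket_J: "bracket (J x) y = J (bracket x y)" "bracket x (J y) = J (bracket x y)"
  by (simp_all add: bracket_simps)

text \<open>The imaginary part of \<open>p x\<close> is \<open>- Re (p (J x))\<close>. This lifts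
  identities for \<open>Re g\<close> to identities for \<open>g\<close>.\<close>

lemma complex_eq_if_Re_eq:
  assumes "\<And>x. Re (p x) = Re (q x)" "\<And>x. p (J x) = \<i> * p x" "\<And>x. q (J x) = \<i> * q x"
  shows "p x = q x"
  using assms(1)[of x] assms(1)[of "J x"] by (simp add: assms(2,3) complex_eq_iff)

context
  fixes \<phi>
  assumes \<phi>: "ad_invariant_endo (restrict_to_real scale) bracket \<phi>"
begin

text \<open>As \<open>\<phi> (J [x,y]) = \<phi> [J x, y] = [J x, \<phi> y] = J (\<phi> [x,y])\<close>, the map \<open>\<phi>\<close> is complex linear
  on the derived algebra.\<close>
lemma antilin_part_bracket: "antilin_part \<phi> (bracket x y) = 0"
proof -
  have "\<phi> (J (bracket x y)) = J (\<phi> (bracket x y))"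
    using \<phi> by (simp add: ad_invariant_endo_def flip: bracket_J(1))
  then show ?thesis
    by (simp add: antilin_part_def)
qed

text \<open>Both \<open>\<phi>\<close> and \<open>J\<close> commute with \<open>bracket x\<close>,
  hence so does the antilinear part, which already vanishes on brackets.\<close>

lemma bracket_antilin_part: "bracket x (antilin_part \<phi> y) = 0"
proof -
  have inv: "\<phi> (bracket x z) = bracket x (\<phi> z)" for z
    using \<phi> by (simp add: ad_invariant_endo_def)
  have "\<phi> (J (bracket x y)) = bracket x (\<phi> (J y))"
    by (simp only: inv flip: bracket_J(2))
  then have "antilin_part \<phi> (bracket x y) = bracket x (antilin_part \<phi> y)"
    by (simp only: antilin_part_def inv bracket_simps)
  then show ?thesis
    by (simp add: antilin_part_bracket)
qed

text \<open>On brackets the linear part agrees with \<open>\<phi>\<close>, and inside a bracket the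
  central antilinear part drops out.\<close>

lemma ad_invariant_lin_part: "ad_invariant_endo scale bracket (lin_part \<phi>)"
proof -
  have "Vector_Spaces.linear (restrict_to_real scale) (restrict_to_real scale) \<phi>"
    using \<phi> by (simp add: ad_invariant_endo_def)
  moreover have "lin_part \<phi> (bracket x y) = bracket x (lin_part \<phi> y)" for x y
  proof -
    have "lin_part \<phi> (bracket x y) = \<phi> (bracket x y)"
      using lin_part_add_antilin_part[of \<phi> "bracket x y"] by (simp add: antilin_part_bracket)
    also have "\<dots> = bracket x (\<phi> y)"
      using \<phi> by (simp add: ad_invariant_endo_def)
    also have "\<dots> = bracket x (lin_part \<phi> y + antilin_part \<phi> y)"
      by (simp add: lin_part_add_antilin_part)
    also have "\<dots> = bracket x (lin_part \<phi> y)"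
      by (simp add: bracket_simps bracket_antilin_part)
    finally show ?thesis .
  qed
  ultimately show ?thesis
    by (simp add: ad_invariant_endo_def linear_lin_part)
qed

text \<open>All three terms of the Leibniz rule are zero: the map kills brackets and has central
  values.\<close>

lemma derivation_half_antilin_part:
  "derivation (restrict_to_real scale) bracket (\<lambda>x. scale (1/2) (antilin_part \<phi> x))"
proof -
  have "bracket (antilin_part \<phi> x) y = 0" for x y
    using bracket_antilin_part[of y x] bracket_anti by (metis neg_0_equal_iff_equal)
  moreover have "Vector_Spaces.linear (restrict_to_real scale) (restrict_to_real scale) (antilin_part \<phi>)"
    using \<phi> real_linear_parts by (simp add: ad_invariant_endo_def)
  ultimately show ?thesis
    by (simp add: derivation_def Vector_Spaces.linear_iff restrict_to_real_def scale_right_distrib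
        bracket_simps bracket_antilin_part antilin_part_bracket mult.commute)
qed

end

text \<open>As \<open>J\<close> can enter a bracket through either slot, there are two formulas for
  \<open>lin_part D\<close> on brackets. Comparing them shows that the antilinear part of
  \<open>D\<close> has central values, so that \<open>D\<close> may be replaced by its linear part
  throughout the Leibniz rule.\<close>

lemma derivation_lin_part:
  assumes D: "derivation (restrict_to_real scale) bracket D"
  shows "derivation scale bracket (lin_part D)"
proof -
  have lin: "Vector_Spaces.linear (restrict_to_real scale) (restrict_to_real scale) D"
    and bracket: "\<And>x y. D (bracket x y) = bracket (D x) y + bracket x (D y)"
    using D by (auto simp: derivation_def)
  \<comment> \<open>With \<open>J\<close> in the first slot only \<open>D x\<close> is averaged;
    \<open>D y\<close> stays whole because its two halves add up.\<close>
  have left: "lin_part D (bracket x y) = bracket (lin_part D x) y + bracket x (D y)" for x y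
  proof -
    have "D (J (bracket x y)) = bracket (D (J x)) y + J (bracket x (D y))"
      using bracket[of "J x" y] by (simp only: bracket_J)
    then show ?thesis
      using scale_half_add_self[of "bracket x (D y)"]
      by (simp add: lin_part_def bracket bracket_simps scale_right_distrib scale_right_diff_distrib add_ac)
  qed
  have right: "lin_part D (bracket x y) = bracket (D x) y + bracket x (lin_part D y)" for x y
  proof -
    have "D (J (bracket x y)) = J (bracket (D x) y) + bracket x (D (J y))"
      using bracket[of x "J y"] by (simp only: bracket_J)
    then show ?thesis
      using scale_half_add_self[of "bracket (D x) y"]
      by (simp add: lin_part_def bracket bracket_simps scale_right_distrib scale_right_diff_distrib add_ac)
  qed
  have swap: "bracket x (antilin_part D y) = bracket (antilin_part D x) y" for x y
  proof -
    have "bracket (lin_part D x) y + bracket x (lin_part D y + antilin_part D y) =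
      bracket (lin_part D x + antilin_part D x) y + bracket x (lin_part D y)"
      using left[of x y] right[of x y] by (simp only: lin_part_add_antilin_part)
    then show ?thesis
      by (simp add: bracket_simps algebra_simps)
  qed
  text \<open>The left-hand side of \<open>swap\<close> is linear in \<open>x\<close>, the right-hand side is antilinear in \<open>x\<close>.\<close>
  have "bracket x (antilin_part D y) = 0" for x y
  proof -
    have "J (bracket x (antilin_part D y)) = - J (bracket (antilin_part D x) y)"
      using swap[of "J x" y] by (simp only: bracket_J antilin_part_J[OF lin] linear_map_minus[OF linear_bracket_left])
    then have "J (bracket x (antilin_part D y)) = - J (bracket x (antilin_part D y))"
      by (simp only: swap)
    then have "scale (\<i> + \<i>) (bracket x (antilin_part D y)) = 0"
      by (simp only: scale_left_distrib eq_neg_iff_add_eq_0)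
    then show ?thesis
      by simp
  qed
  then have "bracket x (D y) = bracket x (lin_part D y)" for x y
    using lin_part_add_antilin_part[of D y] by (metis add.right_neutral bracket_simps(1))
  then show ?thesis
    using left linear_lin_part[OF lin] by (simp add: derivation_def)
qed

lemma finite_dimensional_real:
  obtains C where "finite_dimensional_metric_lie_algebra (restrict_to_real scale) C bracket (\<lambda>x y. Re (g x y))"
  using finite_dimensional_restrict_to_real[OF finite_dimensional_vector_space_axioms]
    R.ad_invariant_metric_axioms finite_dimensional_metric_lie_algebra_def by metis

section \<open>The two implications\<close>

lemma solitary_real_imp_complex:
  assumes sol: "solitary (restrict_to_real scale) bracket"
  shows "solitary scale bracket"
proof -
  obtain C where "finite_dimensional_metric_lie_algebra (restrict_to_real scale) C bracket (\<lambda>x y. Re (g x y))"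
    by (rule finite_dimensional_real)
  then interpret R: finite_dimensional_metric_lie_algebra "restrict_to_real scale" C bracket "\<lambda>x y. Re (g x y)" .
  show ?thesis
    unfolding solitary_iff_solitary_metric solitary_metric_iff
  proof (intro allI impI, elim conjE)
    fix \<phi>
    assume \<phi>: "ad_invariant_endo scale bracket \<phi>" and self: "\<forall>x y. g (\<phi> x) y = g x (\<phi> y)"
    have "ad_invariant_endo (restrict_to_real scale) bracket \<phi>"
      using \<phi> by (simp add: ad_invariant_endo_def linear_restrict_to_real)
    then obtain D where D: "derivation (restrict_to_real scale) bracket D"
      and dec: "\<And>x y. Re (g (\<phi> x) y) = Re (g (D x) y) + Re (g x (D y))"
      using sol self unfolding R.solitary_iff_solitary_metric R.solitary_metric_iff by metis
    have lin: "Vector_Spaces.linear scale scale \<phi>" "Vector_Spaces.linear scale scale (lin_part D)"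
      using \<phi> derivation_lin_part[OF D] by (auto simp: ad_invariant_endo_def derivation_def)
    \<comment> \<open>Replacing \<open>x\<close>, \<open>y\<close> by \<open>J x\<close>,
      \<open>J y\<close> changes the sign of the left-hand side of \<open>dec\<close> and turns
      \<open>D\<close> into \<open>J D J\<close> on the right. Half the difference of the two
      instances is the claim.\<close>
    have "Re (g (\<phi> x) y) = Re (g (lin_part D x) y + g x (lin_part D y))" for x y
      using dec[of x y] dec[of "J x" "J y"]
      by (simp add: lin_part_def metric_simps linear_map_scale[OF lin(1)] algebra_simps)
    then have "g (\<phi> x) y = g (lin_part D x) y + g x (lin_part D y)" for x y
      by (rule complex_eq_if_Re_eq[where p = "\<lambda>x. g (\<phi> x) y" and q = "\<lambda>x. g (lin_part D x) y + g x (lin_part D y)"])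
        (simp_all add: linear_map_scale[OF lin(1)] linear_map_scale[OF lin(2)] metric_simps algebra_simps)
    then show "\<exists>D. derivation scale bracket D \<and> (\<forall>x y. g (\<phi> x) y = g (D x) y + g x (D y))"
      using derivation_lin_part[OF D] by blast
  qed
qed

lemma solitary_complex_imp_real:
  assumes sol: "solitary scale bracket"
  shows "solitary (restrict_to_real scale) bracket"
proof -
  obtain C where "finite_dimensional_metric_lie_algebra (restrict_to_real scale) C bracket (\<lambda>x y. Re (g x y))"
    by (rule finite_dimensional_real)
  then interpret R: finite_dimensional_metric_lie_algebra "restrict_to_real scale" C bracket "\<lambda>x y. Re (g x y)" .
  show ?thesis
    unfolding R.solitary_iff_solitary_metric R.solitary_metric_iff
  proof (intro allI impI, elim conjE)
    fix \<phi>
    assume \<phi>: "ad_invariant_endo (restrict_to_real scale) bracket \<phi>"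
      and self: "\<forall>x y. Re (g (\<phi> x) y) = Re (g x (\<phi> y))"
    have inv: "ad_invariant_endo scale bracket (lin_part \<phi>)"
      by (rule ad_invariant_lin_part[OF \<phi>])
    then have lin: "Vector_Spaces.linear scale scale (lin_part \<phi>)"
      by (simp add: ad_invariant_endo_def)
    \<comment> \<open>Since \<open>J\<close> and \<open>\<phi>\<close> are self-adjoint for
      \<open>Re g\<close>, so is \<open>J \<phi> J\<close>, and with it both parts of
      \<open>\<phi>\<close>.\<close>
    have J_self: "Re (g (J (\<phi> (J x))) y) = Re (g x (J (\<phi> (J y))))" for x y
      using self by (metis metric_J)
    have half: "g (scale (1/2) x) y = g x y / 2" "g x (scale (1/2) y) = g x y / 2" for x y
      by (simp_all add: metric_simps)
    have antilin_self: "Re (g (antilin_part \<phi> x) y) = Re (g x (antilin_part \<phi> y))" for x y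
      unfolding antilin_part_def half using J_self[of x y] self
      by (simp add: metric_simps(1-2) del: scale_scale)
    have "Re (g (lin_part \<phi> x) y) = Re (g x (lin_part \<phi> y))" for x y
      unfolding lin_part_def half using J_self[of x y] self
      by (simp add: metric_simps(3-4))
    then have "g (lin_part \<phi> x) y = g x (lin_part \<phi> y)" for x y
      by (rule complex_eq_if_Re_eq[where p = "\<lambda>x. g (lin_part \<phi> x) y" and q = "\<lambda>x. g x (lin_part \<phi> y)"])
        (simp_all add: linear_map_scale[OF lin] metric_simps)
    then obtain D where D: "derivation scale bracket D"
      and dec: "\<And>x y. g (lin_part \<phi> x) y = g (D x) y + g x (D y)"
      using sol inv unfolding solitary_iff_solitary_metric solitary_metric_iff by metis
    \<comment> \<open>The antilinear part is self-adjoint and is counted twice in the sum of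
      \<open>E\<close> and its adjoint, hence the factor \<open>1/2\<close>.\<close>
    define E where "E x = D x + scale (1/2) (antilin_part \<phi> x)" for x
    have "derivation (restrict_to_real scale) bracket E"
      using D derivation_half_antilin_part[OF \<phi>] R.vector_space_axioms
      by (simp add: E_def derivation_def Vector_Spaces.linear_iff restrict_to_real_def bracket_simps
          algebra_simps del: scale_scale)
    moreover have "Re (g (\<phi> x) y) = Re (g (E x) y) + Re (g x (E y))" for x y
    proof -
      have "g (\<phi> x) y = g (lin_part \<phi> x) y + g (antilin_part \<phi> x) y"
        by (metis lin_part_add_antilin_part metric_simps(2))
      then show ?thesis
        using antilin_self[of x y] by (simp add: dec E_def metric_simps(1-2) half)
    qed
    ultimately show "\<exists>D. derivation (restrict_to_real scale) bracket D \<and>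
        (\<forall>x y. Re (g (\<phi> x) y) = Re (g (D x) y) + Re (g x (D y)))"
      by blast
  qed
qed

end

theorem proposition3p4:
  fixes scale :: "complex \<Rightarrow> 'a::ab_group_add \<Rightarrow> 'a"
    and B :: "'a set"
    and bracket :: "'a \<Rightarrow> 'a \<Rightarrow> 'a"
    and g :: "'a \<Rightarrow> 'a \<Rightarrow> complex"
  assumes "finite_dimensional_vector_space scale B"
    and "lie_algebra scale bracket"
    and "ad_invariant_metric scale bracket g"
  shows "ad_invariant_metric (restrict_to_real scale) bracket (\<lambda>x y. Re (g x y)) \<and>
    (solitary scale bracket \<longleftrightarrow> solitary (restrict_to_real scale) bracket)"
proof -
  interpret complex_metric_lie_algebra scale B bracket g
    using assms by (simp add: complex_metric_lie_algebra_def finite_dimensional_metric_lie_algebra_def)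
  show ?thesis
    using R.ad_invariant_metric_axioms solitary_complex_imp_real solitary_real_imp_complex by blast
qed

end
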